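(* For every integer $r\ge 3$ there exists a family $\mathcal{F}$ of four $r$-graphs such that $\frac{\operatorname{sat}(\mathcal{F},n)}{n^{r-1}}$ does not converge as $n\to\infty$.
   Context: An $r$-graph $H$ is a pair $(V(H),E(H))$ where $V(H)$ is a finite set of vertices and the edge set $E(H)$ is a collection of $r$-element subsets of $V(H)$. Write $|H|=|V(H)|$ and $e(H)=|E(H)|$. Containment of one $r$-graph in another as a subgraph means containing a (not necessarily induced) copy of it. For a family $\mathcal{F}$ of $r$-graphs, an $r$-graph $H$ is called $\mathcal{F}$-saturated if it does not contain any graph in $\mathcal{F}$ as a subgraph, but adding any extra edge (that is, any $r$-element subset of $V(H)$ not in $E(H)$) to $H$ creates a copy of some graph $F\in\mathcal{F}$ as a subgraph. The saturation number is $$\operatorname{sat}(\mathcal{F},n)=\min\{e(H): |H|=n \text{ and } H \text{ is } \mathcal{F}\text{-saturated}\}.$$ *)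

theory Defs
  imports Complex_Main "HOL-Library.Ramsey"
begin

type_synonym 'a hgraph = "'a set \<times> 'a set set"

abbreviation verts :: "'a hgraph \<Rightarrow> 'a set" where
  "verts H \<equiv> fst H"

abbreviation edges :: "'a hgraph \<Rightarrow> 'a set set" where
  "edges H \<equiv> snd H"

definition r_graph :: "nat \<Rightarrow> 'a hgraph \<Rightarrow> bool" where
  "r_graph r H \<longleftrightarrow> finite (verts H) \<and> edges H \<subseteq> nsets (verts H) r"

definition contains_copy :: "'a hgraph \<Rightarrow> 'b hgraph \<Rightarrow> bool" where
  "contains_copy H F \<longleftrightarrow>
     (\<exists>f. inj_on f (verts F) \<and> f ` verts F \<subseteq> verts H \<and> (\<forall>e\<in>edges F. f ` e \<in> edges H))"

definition isomorphic :: "'a hgraph \<Rightarrow> 'b hgraph \<Rightarrow> bool" where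
  "isomorphic G H \<longleftrightarrow>
     (\<exists>f. bij_betw f (verts G) (verts H) \<and> edges H = (\<lambda>e. f ` e) ` edges G)"

definition saturated :: "nat \<Rightarrow> 'b hgraph set \<Rightarrow> 'a hgraph \<Rightarrow> bool" where
  "saturated r \<F> H \<longleftrightarrow>
     r_graph r H \<and>
     (\<forall>F\<in>\<F>. \<not> contains_copy H F) \<and>
     (\<forall>e \<in> nsets (verts H) r - edges H.
        \<exists>F\<in>\<F>. contains_copy (verts H, insert e (edges H)) F)"

(* Every finite r-graph has an isomorphic copy with vertices in nat, so the type nat loses nothing.
   The infimum of a nonempty set of naturals is its minimum. The set below is nonempty for all n
   if every member of the family has an edge. If some F in the family has no edge, the set is empty
   for all n \<ge> |F|; then the value is 0 there, so sat / n^(r-1) would converge. *)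
definition sat :: "nat \<Rightarrow> 'b hgraph set \<Rightarrow> nat \<Rightarrow> nat" where
  "sat r \<F> n = Inf {card (edges H) | H :: nat hgraph. card (verts H) = n \<and> saturated r \<F> H}"

(* Members are counted up to isomorphism. *)
definition r_graph_family :: "nat \<Rightarrow> nat \<Rightarrow> 'a hgraph set \<Rightarrow> bool" where
  "r_graph_family r k \<F> \<longleftrightarrow>
     finite \<F> \<and> card \<F> = k \<and> (\<forall>F\<in>\<F>. r_graph r F) \<and>
     pairwise (\<lambda>F G. \<not> isomorphic F G) \<F>"

end

theory Submission
  imports Defs
begin

text \<open>
  Put \<open>k = 2r\<close>. The family consists of four connected \<open>r\<close>-graphs with more than \<open>k\<close> vertices:
  \<^item> \<open>r - 1\<close> disjoint cliques of size \<open>k\<close> and one edge that meets one of them in two vertices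
    and each of the others in one vertex;
  \<^item> \<open>r\<close> disjoint cliques of size \<open>k\<close> and one edge that meets each of them in one vertex;
  \<^item> cliques of sizes \<open>k\<close> and \<open>r + 1\<close> that share one vertex;
  \<^item> a clique of size \<open>k\<close> and an edge that meets it in \<open>r - 1\<close> vertices.

  If \<open>k\<close> divides \<open>n\<close>, then \<open>n / k\<close> disjoint cliques of size \<open>k\<close> contain no member of the family,
  because a member is connected and does not fit into one of the cliques. In a saturated supergraph on the same vertices,
  the first two members forbid the edges that meet \<open>r - 1\<close> or \<open>r\<close> of these cliques. Only edges
  that meet at most \<open>r - 2\<close> of them remain, and there are \<open>O(n^(r - 2))\<close> of those
  (\<open>sat_osc_upper\<close>).

  If \<open>k\<close> does not divide \<open>n\<close>, then a saturated \<open>H\<close> has at least \<open>((n - 1) choose (r - 1)) / r\<close>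
  edges (\<open>sat_osc_lower\<close>). Suppose that it has fewer. For each vertex \<open>v\<close> there is then a set \<open>T\<close>
  of \<open>r - 1\<close> other vertices that lies in no edge. Adding \<open>T \<union> {v}\<close> creates a member of the
  family, and the members are such that, in this situation, \<open>v\<close> lies in a clique of size \<open>k\<close>
  of \<open>H\<close> (\<open>anchored\<close>, \<open>saturated_vertex_in_clique\<close>). So these cliques cover all vertices.
  The last two members make any two of them disjoint (\<open>cliques_disjoint\<close>), hence \<open>k\<close>
  divides \<open>n\<close>, a contradiction.

  The quotients therefore tend to 0 along the multiples of \<open>k\<close> and stay above a positive
  constant along the numbers \<open>m k + 1\<close>.
\<close>

section \<open>Copies and saturated supergraphs\<close>

text \<open>
  All \<open>r\<close>-subsets of \<open>Q\<close> are edges of \<open>H\<close>. The size of \<open>Q\<close> is not prescribed.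
\<close>
definition clique_in :: "nat \<Rightarrow> 'a hgraph \<Rightarrow> 'a set \<Rightarrow> bool" where
  "clique_in r H Q \<longleftrightarrow> Q \<subseteq> verts H \<and> nsets Q r \<subseteq> edges H"

lemma nsets_image:
  assumes "inj_on f A" "e \<in> nsets A r"
  shows "f ` e \<in> nsets (f ` A) r"
  using assms by (auto simp: nsets_def card_image inj_on_subset)

text \<open>
  An inclusion-maximal edge set that contains the given one and no member of the family is saturated.
\<close>
lemma exists_saturated_supergraph:
  fixes H\<^sub>0 :: "'a hgraph"
  assumes H0: "r_graph r H\<^sub>0" and free: "\<forall>F\<in>\<F>. \<not> contains_copy H\<^sub>0 F"
  shows "\<exists>H. verts H = verts H\<^sub>0 \<and> edges H\<^sub>0 \<subseteq> edges H \<and> saturated r \<F> H"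
proof -
  define S where "S = {E. edges H\<^sub>0 \<subseteq> E \<and> E \<subseteq> nsets (verts H\<^sub>0) r \<and>
    (\<forall>F\<in>\<F>. \<not> contains_copy (verts H\<^sub>0, E) F)}"
  have fin: "finite (nsets (verts H\<^sub>0) r)"
    using H0 by (simp add: r_graph_def finite_imp_finite_nsets)
  have "S \<subseteq> Pow (nsets (verts H\<^sub>0) r)" by (auto simp: S_def)
  with fin have finS: "finite S" by (meson finite_Pow_iff finite_subset)
  have "edges H\<^sub>0 \<in> S" using assms by (simp add: S_def r_graph_def)
  with finS obtain E where E: "E \<in> S" and max: "\<And>E'. E' \<in> S \<Longrightarrow> E \<subseteq> E' \<Longrightarrow> E = E'"
    by (metis empty_iff finite_has_maximal)
  have "saturated r \<F> (verts H\<^sub>0, E)"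
    unfolding saturated_def
  proof (intro conjI ballI)
    show "r_graph r (verts H\<^sub>0, E)" using E H0 by (simp add: S_def r_graph_def)
    show "\<not> contains_copy (verts H\<^sub>0, E) F" if "F \<in> \<F>" for F using E that by (simp add: S_def)
    show "\<exists>F\<in>\<F>. contains_copy (verts (verts H\<^sub>0, E), insert e (edges (verts H\<^sub>0, E))) F"
      if e: "e \<in> nsets (verts (verts H\<^sub>0, E)) r - edges (verts H\<^sub>0, E)" for e
    proof (rule ccontr)
      assume "\<not> ?thesis"
      then have "insert e E \<in> S" using E e by (auto simp: S_def)
      then show False using max[of "insert e E"] e by auto
    qed
  qed
  then show ?thesis using E by (intro exI[of _ "(verts H\<^sub>0, E)"]) (auto simp: S_def)
qed

text \<open>
  If every member has an edge, the edgeless graph extends to a saturated one, so that the infimum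
  in the definition of the saturation number is a minimum.
\<close>
lemma sat_attained:
  assumes ne: "\<forall>F\<in>\<F>. edges F \<noteq> {}"
  obtains H :: "nat hgraph"
  where "card (verts H) = n" "saturated r \<F> H" "sat r \<F> n = card (edges H)"
proof -
  let ?A = "{card (edges H) | H :: nat hgraph. card (verts H) = n \<and> saturated r \<F> H}"
  have "\<exists>H. verts H = verts ({..<n}, {}::nat set set) \<and> edges ({..<n}, {}::nat set set) \<subseteq> edges H
     \<and> saturated r \<F> H"
    using ne by (intro exists_saturated_supergraph) (auto simp: r_graph_def contains_copy_def)
  then obtain H :: "nat hgraph" where "verts H = {..<n}" "saturated r \<F> H" by auto
  then have "card (verts H) = n" by simp
  with \<open>saturated r \<F> H\<close> have "card (edges H) \<in> ?A" by blast
  then have "Inf ?A \<in> ?A" by (intro Inf_nat_def1) blast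
  then show ?thesis using that unfolding sat_def by auto
qed

lemma sat_le:
  fixes H :: "nat hgraph"
  assumes "saturated r \<F> H"
  shows "sat r \<F> (card (verts H)) \<le> card (edges H)"
  unfolding sat_def using assms by (intro wellorder_Inf_le1) blast

section \<open>Anchored hypergraphs and the lower bound\<close>

text \<open>
  For every edge \<open>e\<close> and every vertex \<open>v\<close> of \<open>e\<close>, either \<open>v\<close> lies in a clique of size \<open>k\<close> that does
  not use \<open>e\<close>, or the other vertices of \<open>e\<close> lie together in another edge.
\<close>
definition anchored :: "nat \<Rightarrow> nat \<Rightarrow> 'a hgraph \<Rightarrow> bool" where
  "anchored r k F \<longleftrightarrow> (\<forall>e\<in>edges F. \<forall>v\<in>e.
     (\<exists>Q. clique_in r (verts F, edges F - {e}) Q \<and> card Q = k \<and> v \<in> Q) \<or>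
     (\<exists>e'\<in>edges F. e' \<noteq> e \<and> e - {v} \<subseteq> e'))"

text \<open>
  The new edge \<open>e\<close> is the image of some edge of \<open>F\<close>. Since \<open>e - {v}\<close> lies in no edge of \<open>H\<close>,
  the second alternative of anchoring fails at \<open>v\<close>, and the clique of the first one maps into \<open>H\<close>.
\<close>
lemma clique_of_anchored_copy:
  assumes copy: "contains_copy (verts H, insert e (edges H)) F" and free: "\<not> contains_copy H F"
    and F: "anchored r k F" "r_graph r F"
    and v: "v \<in> e" and shadow: "\<And>g. g \<in> edges H \<Longrightarrow> \<not> e - {v} \<subseteq> g"
  shows "\<exists>Q. clique_in r H Q \<and> card Q = k \<and> v \<in> Q"
proof -
  obtain f where inj: "inj_on f (verts F)" and fV: "f ` verts F \<subseteq> verts H"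
    and fE: "\<And>d. d \<in> edges F \<Longrightarrow> f ` d \<in> insert e (edges H)"
    using copy by (auto simp: contains_copy_def)
  obtain d where d: "d \<in> edges F" "f ` d = e"
    using free fE inj fV unfolding contains_copy_def by blast
  have sub: "g \<subseteq> verts F" if "g \<in> edges F" for g
    using that F(2) by (auto simp: r_graph_def nsets_def)
  have inE: "f ` g \<in> edges H" if "g \<in> edges F" "g \<noteq> d" for g
    using fE[OF that(1)] that d inj sub by (metis inj_on_image_eq_iff insertE)
  obtain u where u: "u \<in> d" "f u = v" using v d by auto
  have "\<not> (\<exists>g\<in>edges F. g \<noteq> d \<and> d - {u} \<subseteq> g)"
  proof
    assume "\<exists>g\<in>edges F. g \<noteq> d \<and> d - {u} \<subseteq> g"
    then obtain g where g: "g \<in> edges F" "g \<noteq> d" "d - {u} \<subseteq> g" by blast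
    then have "e - {v} \<subseteq> f ` g" using d u by auto
    then show False using shadow[OF inE] g by blast
  qed
  then obtain Q where Q: "clique_in r (verts F, edges F - {d}) Q" "card Q = k" "u \<in> Q"
    using F(1) d u unfolding anchored_def by blast
  have QV: "Q \<subseteq> verts F" and injQ: "inj_on f Q"
    using Q(1) inj by (auto simp: clique_in_def inj_on_subset)
  have "nsets (f ` Q) r \<subseteq> edges H"
  proof
    fix g assume g: "g \<in> nsets (f ` Q) r"
    then obtain q where q: "q \<subseteq> Q" "g = f ` q" by (auto simp: nsets_def subset_image_iff)
    have "inj_on f q" using injQ q inj_on_subset by blast
    then have "q \<in> nsets Q r" using g q by (auto simp: nsets_def card_image finite_image_iff)
    then have "q \<in> edges F" "q \<noteq> d" using Q(1) by (auto simp: clique_in_def)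
    then show "g \<in> edges H" using inE q by simp
  qed
  moreover have "f ` Q \<subseteq> verts H" using QV fV by blast
  ultimately show ?thesis
    using Q u injQ by (intro exI[of _ "f ` Q"]) (auto simp: clique_in_def card_image)
qed

lemma saturated_vertex_in_clique:
  assumes sat: "saturated r \<F> H" and anch: "\<And>F. F \<in> \<F> \<Longrightarrow> anchored r k F \<and> r_graph r F"
    and r: "0 < r" and v: "v \<in> verts H"
    and few: "r * card (edges H) < (card (verts H) - 1) choose (r - 1)"
  shows "\<exists>Q. clique_in r H Q \<and> card Q = k \<and> v \<in> Q"
proof -
  have H: "finite (verts H)" "edges H \<subseteq> nsets (verts H) r"
    using sat by (auto simp: saturated_def r_graph_def)
  then have finE: "finite (edges H)" by (meson finite_imp_finite_nsets finite_subset)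
  have fe: "finite g \<and> card g = r" if "g \<in> edges H" for g
    using that H by (auto simp: nsets_def)
  \<comment> \<open>The edges cover fewer \<open>(r - 1)\<close>-sets than there are outside \<open>v\<close>.\<close>
  have "card (\<Union>g\<in>edges H. nsets g (r - 1)) \<le> (\<Sum>g\<in>edges H. card (nsets g (r - 1)))"
    by (rule card_UN_le[OF finE])
  also have "\<dots> = (\<Sum>g\<in>edges H. r)"
  proof (rule sum.cong)
    fix g assume "g \<in> edges H"
    moreover have "r choose (r - 1) = r" using r binomial_symmetric[of "r - 1" r] by simp
    ultimately show "card (nsets g (r - 1)) = r" using fe by simp
  qed simp
  also have "\<dots> < card (nsets (verts H - {v}) (r - 1))"
    using few v H by (simp add: mult.commute)
  finally have less: "card (\<Union>g\<in>edges H. nsets g (r - 1)) < card (nsets (verts H - {v}) (r - 1))" .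
  have "finite (\<Union>g\<in>edges H. nsets g (r - 1))"
    using finE fe by (auto simp: finite_imp_finite_nsets)
  then have "\<not> nsets (verts H - {v}) (r - 1) \<subseteq> (\<Union>g\<in>edges H. nsets g (r - 1))"
    using less card_mono by (metis linorder_not_less)
  then obtain T where T: "T \<in> nsets (verts H - {v}) (r - 1)"
    and "T \<notin> (\<Union>g\<in>edges H. nsets g (r - 1))" by blast
  then have shadow: "\<And>g. g \<in> edges H \<Longrightarrow> \<not> T \<subseteq> g" by (auto simp: nsets_def)
  have Tv: "insert v T - {v} = T" using T by (auto simp: nsets_def)
  have "v \<notin> T" "finite T" "card T = r - 1" using T by (auto simp: nsets_def)
  then have "insert v T \<in> nsets (verts H) r" using T v r by (auto simp: nsets_def)
  moreover have "insert v T \<notin> edges H" using shadow by blast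
  ultimately obtain F where F: "F \<in> \<F>"
    and copy: "contains_copy (verts H, insert (insert v T) (edges H)) F"
    using sat unfolding saturated_def by blast
  show ?thesis
    by (rule clique_of_anchored_copy[OF copy])
      (use F sat anch shadow Tv in \<open>auto simp: saturated_def\<close>)
qed

section \<open>Two overlapping cliques\<close>

text \<open>
  A clique of size \<open>s\<close> and one of size \<open>t\<close> sharing \<open>i\<close> vertices, placed on consecutive numbers
  so that the shared vertices are the last \<open>i\<close> of the first clique. The truncated subtractions are
  exact for \<open>i \<le> s\<close> and \<open>i \<le> t\<close>.
\<close>
definition two_cliques :: "nat \<Rightarrow> nat \<Rightarrow> nat \<Rightarrow> nat \<Rightarrow> nat hgraph" where
  "two_cliques r s t i = ({..<s + t - i}, nsets {..<s} r \<union> nsets {s - i..<s + t - i} r)"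

lemma contains_two_cliques:
  assumes A: "clique_in r H A" "finite A" "card A = s"
    and B: "clique_in r H B" "finite B" "card B = t" and i: "card (A \<inter> B) = i"
  shows "contains_copy H (two_cliques r s t i)"
proof -
  have i_le: "i \<le> s" "i \<le> t" using A B i by (auto intro: card_mono)
  have cAB: "card (A - B) = s - i" using A B i by (simp add: card_Diff_subset_Int)
  have cBA: "card (B - A) = t - i" using A B i by (simp add: card_Diff_subset_Int Int_commute)
  obtain f1 where f1: "bij_betw f1 {..<s - i} (A - B)"
    using finite_same_card_bij[of "{..<s - i}" "A - B"] A cAB by auto
  obtain f2 where f2: "bij_betw f2 {s - i..<s} (A \<inter> B)"
    using finite_same_card_bij[of "{s - i..<s}" "A \<inter> B"] A i i_le by auto
  obtain f3 where f3: "bij_betw f3 {s..<s + t - i} (B - A)"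
    using finite_same_card_bij[of "{s..<s + t - i}" "B - A"] B cBA i_le by auto
  define f where "f x = (if x < s - i then f1 x else if x < s then f2 x else f3 x)" for x
  have g1: "bij_betw f {..<s - i} (A - B)"
    using f1 by (rule bij_betw_cong[THEN iffD1, rotated]) (auto simp: f_def)
  have g2: "bij_betw f {s - i..<s} (A \<inter> B)"
    using f2 by (rule bij_betw_cong[THEN iffD1, rotated]) (auto simp: f_def)
  have g3: "bij_betw f {s..<s + t - i} (B - A)"
    using f3 i_le by (intro bij_betw_cong[THEN iffD1, rotated, OF f3]) (auto simp: f_def)
  have gA: "bij_betw f {..<s} A"
  proof -
    have "{..<s - i} \<union> {s - i..<s} = {..<s}" using i_le by auto
    moreover have "(A - B) \<union> (A \<inter> B) = A" "(A - B) \<inter> (A \<inter> B) = {}" by auto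
    ultimately show ?thesis using bij_betw_combine[OF g1 g2] by simp
  qed
  have gB: "bij_betw f {s - i..<s + t - i} B"
  proof -
    have "{s - i..<s} \<union> {s..<s + t - i} = {s - i..<s + t - i}" using i_le by auto
    moreover have "(A \<inter> B) \<union> (B - A) = B" "(A \<inter> B) \<inter> (B - A) = {}" by auto
    ultimately show ?thesis using bij_betw_combine[OF g2 g3] by simp
  qed
  have gAB: "bij_betw f {..<s + t - i} (A \<union> B)"
  proof -
    have "{..<s} \<union> {s..<s + t - i} = {..<s + t - i}" using i_le by auto
    moreover have "A \<union> (B - A) = A \<union> B" "A \<inter> (B - A) = {}" by auto
    ultimately show ?thesis using bij_betw_combine[OF gA g3] by simp
  qed
  have "f ` e \<in> edges H" if "e \<in> nsets {..<s} r \<union> nsets {s - i..<s + t - i} r" for e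
    using that nsets_image[of f _ e r] gA gB A(1) B(1) unfolding bij_betw_def clique_in_def by blast
  moreover have "A \<union> B \<subseteq> verts H" using A B by (auto simp: clique_in_def)
  ultimately show ?thesis
    using gAB unfolding contains_copy_def two_cliques_def
    by (intro exI[of _ f]) (auto simp: bij_betw_def)
qed

lemma r_graph_two_cliques:
  assumes "i \<le> t"
  shows "r_graph r (two_cliques r s t i)"
proof -
  have "{..<s} \<subseteq> {..<s + t - i}" "{s - i..<s + t - i} \<subseteq> {..<s + t - i}" using assms by auto
  then have "nsets {..<s} r \<subseteq> nsets {..<s + t - i} r"
    "nsets {s - i..<s + t - i} r \<subseteq> nsets {..<s + t - i} r" by (auto simp only: nsets_mono)
  then show ?thesis unfolding r_graph_def two_cliques_def by simp
qed

lemma clique_in_subset: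
  assumes "clique_in r H Q" "A \<subseteq> Q"
  shows "clique_in r H A"
  using assms nsets_mono[of A Q r] by (auto simp: clique_in_def)

text \<open>
  Two distinct intersecting cliques \<open>Q\<close> and \<open>Q'\<close> of size \<open>k\<close> contain one of only two configurations,
  whatever the size of their intersection. If it has at least \<open>r - 1\<close> elements, some edge inside \<open>Q'\<close>
  leaves \<open>Q\<close> in a single vertex. Otherwise \<open>k \<ge> 2r\<close> leaves at least \<open>r\<close> vertices of \<open>Q'\<close>
  outside \<open>Q\<close>; any \<open>r\<close> of them and one shared vertex form a clique of size \<open>r + 1\<close>.
\<close>
lemma cliques_disjoint:
  assumes Q: "clique_in r H Q" "card Q = k" and Q': "clique_in r H Q'" "card Q' = k"
    and fin: "finite Q" "finite Q'" and ne: "Q \<noteq> Q'" and k: "2 * r \<le> k" and r: "2 \<le> r"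
    and free: "\<not> contains_copy H (two_cliques r k (r + 1) 1)"
      "\<not> contains_copy H (two_cliques r k r (r - 1))"
  shows "Q \<inter> Q' = {}"
proof (rule ccontr)
  assume "Q \<inter> Q' \<noteq> {}"
  then obtain q where q: "q \<in> Q" "q \<in> Q'" by auto
  show False
  proof (cases "r - 1 \<le> card (Q \<inter> Q')")
    case True
    then obtain I where I: "I \<subseteq> Q \<inter> Q'" "card I = r - 1" "finite I"
      using obtain_subset_with_card_n by metis
    obtain w where w: "w \<in> Q'" "w \<notin> Q"
      using ne Q Q' fin by (metis card_subset_eq subsetI)
    have "Q \<inter> insert w I = I" using I w by auto
    then have "contains_copy H (two_cliques r k r (r - 1))"
      using I w Q Q' fin r
      by (intro contains_two_cliques[of r H Q k "insert w I"]) (auto intro: clique_in_subset[of r H Q'])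
    then show False using free by blast
  next
    case False
    have "card (Q' - Q) = k - card (Q \<inter> Q')"
      using Q' fin by (simp add: card_Diff_subset_Int Int_commute)
    then have "r \<le> card (Q' - Q)" using False k by linarith
    then obtain W where W: "W \<subseteq> Q' - Q" "card W = r" "finite W"
      using obtain_subset_with_card_n by metis
    have "Q \<inter> insert q W = {q}" using W q by auto
    moreover have "q \<notin> W" using W q by auto
    moreover have "clique_in r H (insert q W)"
      by (rule clique_in_subset[OF Q'(1)]) (use W q in auto)
    ultimately have "contains_copy H (two_cliques r k (r + 1) 1)"
      using W Q fin by (intro contains_two_cliques[of r H Q k "insert q W"]) auto
    then show False using free by blast
  qed
qed

lemma dvd_card_of_clique_partition:
  assumes fin: "finite (verts H)"
    and cover: "\<And>v. v \<in> verts H \<Longrightarrow> \<exists>Q. clique_in r H Q \<and> card Q = k \<and> v \<in> Q"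
    and disj: "\<And>Q Q'. clique_in r H Q \<Longrightarrow> card Q = k \<Longrightarrow> clique_in r H Q' \<Longrightarrow> card Q' = k \<Longrightarrow>
      Q \<noteq> Q' \<Longrightarrow> Q \<inter> Q' = {}"
  shows "k dvd card (verts H)"
proof -
  define C where "C = {Q. clique_in r H Q \<and> card Q = k}"
  have sub: "C \<subseteq> Pow (verts H)" by (auto simp: C_def clique_in_def)
  have U: "\<Union>C = verts H" using cover sub by (auto simp: C_def)
  have "k * card C = card (\<Union>C)"
    by (rule card_partition) (use sub fin U disj in \<open>auto simp: C_def intro: finite_subset\<close>)
  then show ?thesis using U by (metis dvd_triv_left)
qed

lemma clique_edge_covered:
  assumes e: "e \<in> nsets A r" and A: "finite A" "r < card A" and v: "v \<in> e"
  shows "\<exists>e'\<in>nsets A r. e' \<noteq> e \<and> e - {v} \<subseteq> e'"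
proof -
  have e': "e \<subseteq> A" "finite e" "card e = r" using e by (auto simp: nsets_def)
  then obtain w where w: "w \<in> A" "w \<notin> e"
    using A by (metis less_irrefl subset_antisym subsetI)
  have "0 < r" using e' v card_gt_0_iff by blast
  then have "insert w (e - {v}) \<in> nsets A r" using e' w v by (auto simp: nsets_def)
  moreover have "insert w (e - {v}) \<noteq> e" using w by auto
  ultimately show ?thesis by (intro bexI[of _ "insert w (e - {v})"]) auto
qed

lemma anchored_two_cliques_single:
  assumes "r < k"
  shows "anchored r k (two_cliques r k (r + 1) 1)"
proof -
  have "\<exists>e'\<in>edges (two_cliques r k (r + 1) 1). e' \<noteq> e \<and> e - {v} \<subseteq> e'"
    if "e \<in> edges (two_cliques r k (r + 1) 1)" "v \<in> e" for e v
    using that clique_edge_covered[of e "{..<k}" r v]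
      clique_edge_covered[of e "{k - 1..<k + (r + 1) - 1}" r v] assms
    by (auto simp: two_cliques_def)
  then show ?thesis unfolding anchored_def by blast
qed

text \<open>
  The second clique of this graph is a single edge. Its only vertex outside the first clique is \<open>k\<close>,
  and the other \<open>r - 1\<close> vertices lie in another edge, inside the first clique.
\<close>
lemma anchored_two_cliques_large:
  assumes "r < k" "1 \<le> r"
  shows "anchored r k (two_cliques r k r (r - 1))"
proof -
  let ?F = "two_cliques r k r (r - 1)"
  let ?d = "{k - (r - 1)..<k + 1}"
  have F: "?F = ({..<k + 1}, insert ?d (nsets {..<k} r))"
  proof -
    have 1: "k + r - (r - 1) = k + 1" using assms by simp
    have "card ?d = r" using assms by simp
    then have "N \<in> nsets ?d r \<longleftrightarrow> N = ?d" for N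
      using card_subset_eq[of ?d N] unfolding nsets_def by auto
    then have "nsets ?d r = {?d}" by blast
    then show ?thesis unfolding two_cliques_def 1 by auto
  qed
  have "k \<in> ?d" using assms by simp
  then have d: "?d \<notin> nsets {..<k} r" unfolding nsets_def by blast
  show ?thesis unfolding anchored_def F
  proof (intro ballI)
    fix e v assume e: "e \<in> edges ({..<k + 1}, insert ?d (nsets {..<k} r))" and v: "v \<in> e"
    show "(\<exists>Q. clique_in r (verts ({..<k + 1}, insert ?d (nsets {..<k} r)),
        edges ({..<k + 1}, insert ?d (nsets {..<k} r)) - {e}) Q \<and> card Q = k \<and> v \<in> Q) \<or>
      (\<exists>e'\<in>edges ({..<k + 1}, insert ?d (nsets {..<k} r)). e' \<noteq> e \<and> e - {v} \<subseteq> e')"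
    proof (cases "e = ?d")
      case False
      then have "e \<in> nsets {..<k} r" using e by simp
      then show ?thesis using clique_edge_covered[of e "{..<k}" r v] v assms by auto
    next
      case ed: True
      show ?thesis
      proof (cases "v < k")
        case True
        then have "clique_in r ({..<k + 1}, insert ?d (nsets {..<k} r) - {e}) {..<k}"
          using d ed by (auto simp: clique_in_def)
        then show ?thesis using True by auto
      next
        case False
        then have "v = k" using v ed by auto
        then have "e - {v} \<subseteq> {k - r..<k}" using ed assms by auto
        moreover have "{k - r..<k} \<in> nsets {..<k} r" using assms by (auto simp: nsets_def)
        moreover have "{k - r..<k} \<noteq> e" using d ed calculation(2) by auto
        ultimately show ?thesis by auto
      qed
    qed
  qed
qed

section \<open>Disjoint cliques with one additional edge\<close>

text \<open>
  The edges of \<open>m\<close> disjoint cliques of size \<open>k\<close> on the numbers below \<open>m k\<close>. The cliques are the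
  blocks of \<open>k\<close> consecutive numbers, so that \<open>x div k\<close> is the index of the block of \<open>x\<close>.
\<close>
definition block_edges :: "nat \<Rightarrow> nat \<Rightarrow> nat \<Rightarrow> nat set set" where
  "block_edges r k m = {e \<in> nsets {..<m * k} r. \<exists>p. \<forall>x\<in>e. x div k = p}"

text \<open>
  An edge that meets each of the first \<open>j\<close> blocks, used for \<open>j = r\<close> and \<open>j = r - 1\<close>. It contains the
  first number of each block. The extra element \<open>r - j\<close> is 0, which is no new one, if \<open>j = r\<close>;
  it is 1, a second element of the first block, if \<open>j = r - 1\<close>.
\<close>
definition bridge :: "nat \<Rightarrow> nat \<Rightarrow> nat \<Rightarrow> nat set" where
  "bridge r k j = insert (r - j) ((\<lambda>i. i * k) ` {..<j})"

text \<open>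
  The graph of \<open>j\<close> disjoint cliques of size \<open>k\<close> with the bridge as an additional edge.
\<close>
definition bridged_cliques :: "nat \<Rightarrow> nat \<Rightarrow> nat \<Rightarrow> nat hgraph" where
  "bridged_cliques r k j = ({..<j * k}, insert (bridge r k j) (block_edges r k j))"

lemma block_eq_div:
  assumes "0 < k"
  shows "(x::nat) \<in> {p * k..<p * k + k} \<longleftrightarrow> x div k = p"
proof
  show "x div k = p" if "x \<in> {p * k..<p * k + k}"
    using that by (intro div_nat_eqI) (auto simp: algebra_simps)
  show "x \<in> {p * k..<p * k + k}" if "x div k = p"
    using that div_mult_mod_eq[of x k] mod_less_divisor[OF assms, of x] by auto
qed

text \<open>
  A bijection with prescribed values at 0 and \<open>c\<close>. The case \<open>c = 0\<close> prescribes only one value.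
\<close>
lemma exists_marked_bij:
  assumes A: "finite A" "card A = n" and x: "x \<in> A" "z \<in> A" and c: "c < n" "c = 0 \<longleftrightarrow> x = z"
  shows "\<exists>h. bij_betw h {..<n} A \<and> h 0 = x \<and> h c = z"
proof -
  have "card {0, c} = card {x, z}" using c by auto
  then have "card ({..<n} - {0, c}) = card (A - {x, z})"
    using A x c by (subst (1 2) card_Diff_subset) auto
  then obtain b where b: "bij_betw b ({..<n} - {0, c}) (A - {x, z})"
    using finite_same_card_bij[of "{..<n} - {0, c}" "A - {x, z}"] A by auto
  define h where "h i = (if i = 0 then x else if i = c then z else b i)" for i
  have "bij_betw h {0, c} {x, z}" using c by (auto simp: bij_betw_def h_def inj_on_def)
  moreover have "bij_betw h ({..<n} - {0, c}) (A - {x, z})"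
    using b by (rule bij_betw_cong[THEN iffD1, rotated]) (auto simp: h_def)
  ultimately have "bij_betw h ({0, c} \<union> ({..<n} - {0, c})) ({x, z} \<union> (A - {x, z}))"
    by (rule bij_betw_combine) auto
  moreover have "{0, c} \<union> ({..<n} - {0, c}) = {..<n}" "{x, z} \<union> (A - {x, z}) = A"
    using c x by auto
  ultimately have "bij_betw h {..<n} A" by simp
  moreover have "h 0 = x" "h c = z" using c by (auto simp: h_def)
  ultimately show ?thesis by blast
qed

text \<open>
  An edge that meets exactly \<open>j\<close> blocks, where \<open>j\<close> is \<open>r\<close> or \<open>r - 1\<close>, together with these blocks,
  is a copy of the bridged cliques. The copy is assembled from a bijection \<open>g\<close> between block indices
  and one bijection \<open>h p\<close> onto each block \<open>p\<close>, marked at the elements of the edge.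
\<close>
lemma contains_bridged_cliques:
  assumes V: "verts H = {..<m * k}" and blocks: "block_edges r k m \<subseteq> edges H"
    and e: "e \<in> edges H" "e \<in> nsets {..<m * k} r"
    and j: "card ((\<lambda>x. x div k) ` e) = j" and rj: "r \<le> j + 1" and j0: "0 < j" and k: "2 \<le> k"
  shows "contains_copy H (bridged_cliques r k j)"
proof -
  define P where "P = (\<lambda>x. x div k) ` e"
  have e': "finite e" "card e = r" "e \<subseteq> {..<m * k}" using e by (auto simp: nsets_def)
  have P: "finite P" "card P = j" using e' j by (auto simp: P_def)
  have "\<forall>p\<in>P. \<exists>y\<in>e. y div k = p" by (auto simp: P_def)
  then obtain y where y: "\<And>p. p \<in> P \<Longrightarrow> y p \<in> e" "\<And>p. p \<in> P \<Longrightarrow> y p div k = p" by metis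
  have "inj_on y P" using y(2) by (rule inj_on_inverseI)
  then have yP: "y ` P \<subseteq> e" "card (y ` P) = j" using y(1) P by (auto simp: card_image)
  have jr: "j \<le> r" using e' j card_image_le by blast
  \<comment> \<open>Besides one element \<open>y p\<close> in each block, \<open>e\<close> has at most one further element \<open>z\<close>.\<close>
  have "\<exists>z\<in>e. e = insert z (y ` P) \<and> (r - j = 0 \<longleftrightarrow> y (z div k) = z)"
  proof (cases "r = j")
    case True
    then have eq: "y ` P = e" using yP e' card_subset_eq by blast
    obtain p where "p \<in> P" using P j0 by fastforce
    then show ?thesis using y eq True by (intro bexI[of _ "y p"]) auto
  next
    case False
    then have "card (e - y ` P) = 1" using jr rj yP e' by (simp add: card_Diff_subset P)
    then obtain z where z: "e - y ` P = {z}" by (auto simp: card_1_singleton_iff)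
    then have "z \<in> e" "z \<notin> y ` P" by auto
    moreover have "z div k \<in> P" using \<open>z \<in> e\<close> by (auto simp: P_def)
    ultimately have "y (z div k) \<noteq> z" by force
    then show ?thesis using z yP False jr by (intro bexI[of _ z]) auto
  qed
  then obtain z where z: "z \<in> e" "e = insert z (y ` P)" "r - j = 0 \<longleftrightarrow> y (z div k) = z"
    by (elim bexE conjE) (erule (2) that)
  have zP: "z div k \<in> P" using z(1) by (auto simp: P_def)
  obtain g where g: "bij_betw g {..<j} P" "g 0 = z div k"
    using exists_marked_bij[OF P zP zP, of 0] j0 by auto
  have "\<exists>h. bij_betw h {..<k} {p * k..<p * k + k} \<and> h 0 = y p \<and> (p = z div k \<longrightarrow> h (r - j) = z)"
    if p: "p \<in> P" for p
  proof -
    have blk: "x \<in> {x div k * k..<x div k * k + k}" for x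
      using k by (subst block_eq_div) auto
    have yp: "y p \<in> {p * k..<p * k + k}" using blk[of "y p"] y(2)[OF p] by simp
    show ?thesis
    proof (cases "p = z div k")
      case True
      have zz: "z \<in> {p * k..<p * k + k}" using blk[of z] True by simp
      show ?thesis
        using exists_marked_bij[OF _ _ yp zz, of k "r - j"] True z(3) rj k by auto
    next
      case False
      then show ?thesis using exists_marked_bij[OF _ _ yp yp, of k 0] k by auto
    qed
  qed
  then obtain h where h: "\<And>p. p \<in> P \<Longrightarrow> bij_betw (h p) {..<k} {p * k..<p * k + k}"
      "\<And>p. p \<in> P \<Longrightarrow> h p 0 = y p" "h (z div k) (r - j) = z"
    using zP by metis
  define f where "f x = h (g (x div k)) (x mod k)" for x
  have gP: "g i \<in> P" if "i < j" for i using g that by (auto simp: bij_betw_def)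
  have xj: "x div k < j" if "x < j * k" for x using that k by (simp add: less_mult_imp_div_less)
  have fdiv: "f x div k = g (x div k)" if "x < j * k" for x
  proof -
    let ?p = "g (x div k)"
    have "f x \<in> {?p * k..<?p * k + k}"
      using h(1)[OF gP[OF xj[OF that]]] k unfolding f_def bij_betw_def by auto
    then show ?thesis using k by (subst (asm) block_eq_div) auto
  qed
  have inj: "inj_on f {..<j * k}"
  proof (rule inj_onI)
    fix x x' assume xx: "x \<in> {..<j * k}" "x' \<in> {..<j * k}" "f x = f x'"
    then have "g (x div k) = g (x' div k)" using fdiv by (metis lessThan_iff)
    then have d: "x div k = x' div k"
      using g xj xx by (metis bij_betw_def inj_onD lessThan_iff)
    have "inj_on (h (g (x div k))) {..<k}"
      using h(1)[OF gP[OF xj]] xx by (auto simp: bij_betw_def)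
    then have "x mod k = x' mod k"
      using xx(3) d k unfolding f_def by (auto dest: inj_onD)
    with d show "x = x'" by (metis div_mult_mod_eq)
  qed
  have Pm: "p < m" if "p \<in> P" for p
    using that e'(3) by (auto simp: P_def less_mult_imp_div_less)
  have fV: "f ` {..<j * k} \<subseteq> {..<m * k}"
  proof
    fix a assume "a \<in> f ` {..<j * k}"
    then have "a div k < m" using fdiv gP xj Pm by auto
    then show "a \<in> {..<m * k}" using k by (simp add: div_less_iff_less_mult)
  qed
  have "f ` d \<in> edges H" if d: "d \<in> block_edges r k j" for d
  proof -
    have dn: "d \<in> nsets {..<j * k} r" and "\<exists>p. \<forall>x\<in>d. x div k = p"
      using d by (auto simp: block_edges_def)
    then obtain p where p: "\<And>x. x \<in> d \<Longrightarrow> x div k = p" by blast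
    have "d \<subseteq> {..<j * k}" using dn by (auto simp: nsets_def)
    then have "\<forall>a\<in>f ` d. a div k = g p" using p fdiv by auto
    moreover have "f ` d \<in> nsets {..<m * k} r"
      using nsets_image[OF inj dn] fV nsets_mono by blast
    ultimately show ?thesis using blocks by (auto simp: block_edges_def)
  qed
  moreover have "f ` bridge r k j = e"
  proof -
    have "f (i * k) = y (g i)" if "i < j" for i using k h(2)[OF gP[OF that]] by (simp add: f_def)
    then have "f ` (\<lambda>i. i * k) ` {..<j} = y ` g ` {..<j}" by (auto simp: image_image)
    moreover have "g ` {..<j} = P" using g by (simp add: bij_betw_def)
    moreover have "f (r - j) = z"
    proof -
      have "r - j < k" using rj k by simp
      then show ?thesis using g h(3) by (simp add: f_def)
    qed
    ultimately show ?thesis using z(2) by (simp add: bridge_def)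
  qed
  ultimately show ?thesis
    using inj fV V e(1) unfolding contains_copy_def bridged_cliques_def
    by (intro exI[of _ f]) auto
qed

lemma bridge_in_nsets:
  assumes "j \<le> r" "r \<le> j + 1" "0 < j" "2 \<le> k"
  shows "bridge r k j \<in> nsets {..<j * k} r"
proof -
  have inj: "inj_on (\<lambda>i. i * k) {..<j}" using assms by (auto simp: inj_on_def)
  have "i * k < j * k" if "i < j" for i using that assms by simp
  moreover have "k \<le> j * k" using assms by simp
  then have "r - j < j * k" using assms by linarith
  ultimately have sub: "bridge r k j \<subseteq> {..<j * k}" by (auto simp: bridge_def)
  have "card (bridge r k j) = r"
  proof (cases "r = j")
    case True
    have "0 \<in> (\<lambda>i. i * k) ` {..<j}" using assms by force
    then show ?thesis using True inj by (simp add: bridge_def insert_absorb card_image)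
  next
    case False
    then have 1: "r - j = 1" using assms by simp
    have "1 \<notin> (\<lambda>i. i * k) ` {..<j}" using assms by auto
    then show ?thesis using 1 inj assms by (simp add: bridge_def card_image)
  qed
  then show ?thesis using sub finite_subset[OF sub] by (auto simp: nsets_def)
qed

lemma bridge_parts:
  assumes "r \<le> j + 1" "0 < j" "2 \<le> k"
  shows "(\<lambda>x. x div k) ` bridge r k j = {..<j}"
proof -
  have "(r - j) div k = 0" using assms by simp
  then show ?thesis using assms by (auto simp: bridge_def image_image)
qed

lemma r_graph_bridged_cliques:
  assumes "j \<le> r" "r \<le> j + 1" "0 < j" "2 \<le> k"
  shows "r_graph r (bridged_cliques r k j)"
  using bridge_in_nsets[OF assms] by (auto simp: r_graph_def bridged_cliques_def block_edges_def)

text \<open>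
  Every vertex lies in one of the cliques, none of which contains the bridge; this serves the
  vertices of the bridge. Every other edge lies in a clique with more than \<open>r\<close> vertices.
\<close>
lemma anchored_bridged_cliques:
  assumes j: "j \<le> r" "r \<le> j + 1" "2 \<le> j" and k: "r < k"
  shows "anchored r k (bridged_cliques r k j)"
  unfolding anchored_def
proof (intro ballI)
  fix e v assume e: "e \<in> edges (bridged_cliques r k j)" and v: "v \<in> e"
  have br: "bridge r k j \<in> nsets {..<j * k} r" using j k by (intro bridge_in_nsets) auto
  define A where "A = {v div k * k..<v div k * k + k}"
  have A_iff: "x \<in> A \<longleftrightarrow> x div k = v div k" for x
    unfolding A_def using k by (intro block_eq_div) auto
  then have Adiv: "\<And>x. x \<in> A \<Longrightarrow> x div k = v div k" and inA: "\<And>x. x div k = v div k \<Longrightarrow> x \<in> A"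
    by auto
  have "v < j * k" using e v br by (auto simp: bridged_cliques_def block_edges_def nsets_def)
  then have vj: "v div k < j" by (simp add: less_mult_imp_div_less)
  then have "v div k * k + k \<le> j * k" using mult_le_mono1[OF Suc_leI, of _ j k] by (simp add: add.commute)
  then have AV: "A \<subseteq> {..<j * k}" by (auto simp: A_def)
  have cl: "nsets A r \<subseteq> block_edges r k j"
    using Adiv nsets_mono[OF AV, of r] by (auto simp: block_edges_def nsets_def)
  have cA: "finite A" "card A = k" by (auto simp: A_def)
  have nbr: "bridge r k j \<notin> nsets A r"
  proof
    assume "bridge r k j \<in> nsets A r"
    then have "(\<lambda>x. x div k) ` bridge r k j \<subseteq> {v div k}" using Adiv by (auto simp: nsets_def)
    then have "{..<j} \<subseteq> {v div k}" using bridge_parts[of r j k] j k by simp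
    then have "card {..<j} \<le> card {v div k}" by (intro card_mono) auto
    then show False using j by simp
  qed
  show "(\<exists>Q. clique_in r (verts (bridged_cliques r k j), edges (bridged_cliques r k j) - {e}) Q \<and>
        card Q = k \<and> v \<in> Q) \<or>
    (\<exists>e'\<in>edges (bridged_cliques r k j). e' \<noteq> e \<and> e - {v} \<subseteq> e')"
  proof (cases "e = bridge r k j")
    case True
    then have "clique_in r (verts (bridged_cliques r k j), edges (bridged_cliques r k j) - {e}) A"
      using AV cl nbr by (auto simp: clique_in_def bridged_cliques_def)
    then show ?thesis using cA inA by blast
  next
    case False
    then have "e \<in> block_edges r k j" using e by (simp add: bridged_cliques_def)
    then have "e \<in> nsets A r" using v inA by (auto simp: block_edges_def nsets_def)
    then show ?thesis
      using clique_edge_covered[of e A r v] cA k v cl by (auto simp: bridged_cliques_def)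
  qed
qed

section \<open>The upper bound\<close>

lemma constant_on_clique:
  assumes const: "\<And>e. e \<in> nsets A r \<Longrightarrow> \<exists>p. \<forall>x\<in>e. \<phi> x = p"
    and A: "finite A" "r \<le> card A" and r: "2 \<le> r" and xy: "x \<in> A" "y \<in> A"
  shows "\<phi> x = \<phi> y"
proof -
  have "card {x, y} \<le> r" using r by (simp add: card_insert_if)
  then obtain e where "{x, y} \<subseteq> e" "e \<subseteq> A" "card e = r"
    using exists_subset_between[of "{x, y}" r A] A xy by auto
  then have "e \<in> nsets A r" using A finite_subset by (auto simp: nsets_def)
  with const obtain p where "\<forall>x\<in>e. \<phi> x = p" by blast
  then show ?thesis using \<open>{x, y} \<subseteq> e\<close> by auto
qed

text \<open>
  The last assumption says that \<open>F\<close> is connected: a function that is constant on each edge is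
  constant. Applied to the block index along a copy of \<open>F\<close>, it puts the copy into a single block,
  which has only \<open>k\<close> vertices.
\<close>
lemma block_graph_free:
  assumes F: "finite (verts F)" "k < card (verts F)" and k: "0 < k"
    and conn: "\<And>\<phi> :: 'a \<Rightarrow> nat. (\<And>e. e \<in> edges F \<Longrightarrow> \<exists>p. \<forall>x\<in>e. \<phi> x = p) \<Longrightarrow>
      \<exists>p. \<forall>x\<in>verts F. \<phi> x = p"
  shows "\<not> contains_copy ({..<m * k}, block_edges r k m) F"
proof
  assume "contains_copy ({..<m * k}, block_edges r k m) F"
  then obtain f where f: "inj_on f (verts F)" "\<And>e. e \<in> edges F \<Longrightarrow> f ` e \<in> block_edges r k m"
    by (auto simp: contains_copy_def)
  have "\<exists>p. \<forall>x\<in>e. f x div k = p" if "e \<in> edges F" for e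
    using f(2)[OF that] by (auto simp: block_edges_def)
  then obtain p where p: "\<And>x. x \<in> verts F \<Longrightarrow> f x div k = p"
    using conn[of "\<lambda>x. f x div k"] by blast
  have "f ` verts F \<subseteq> {p * k..<p * k + k}"
  proof
    fix a assume "a \<in> f ` verts F"
    then have "a div k = p" using p by auto
    then show "a \<in> {p * k..<p * k + k}" using k by (simp only: block_eq_div)
  qed
  then have "card (f ` verts F) \<le> card {p * k..<p * k + k}" by (intro card_mono) auto
  then show False using F f(1) by (simp add: card_image)
qed

lemma two_cliques_block_free:
  assumes "2 \<le> r" "r \<le> s" "r \<le> t" "0 < i" "i < t" "i \<le> s"
  shows "\<not> contains_copy ({..<m * s}, block_edges r s m) (two_cliques r s t i)"
proof (rule block_graph_free)
  show "\<exists>p. \<forall>x\<in>verts (two_cliques r s t i). \<phi> x = p"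
    if c: "\<And>e. e \<in> edges (two_cliques r s t i) \<Longrightarrow> \<exists>p. \<forall>x\<in>e. \<phi> x = p" for \<phi> :: "nat \<Rightarrow> nat"
  proof (intro exI ballI)
    fix x assume x: "x \<in> verts (two_cliques r s t i)"
    have A: "\<phi> x = \<phi> y" if "x \<in> {..<s}" "y \<in> {..<s}" for x y
      by (rule constant_on_clique[of "{..<s}" r]) (use c that assms in \<open>auto simp: two_cliques_def\<close>)
    have B: "\<phi> x = \<phi> y" if "x \<in> {s - i..<s + t - i}" "y \<in> {s - i..<s + t - i}" for x y
      by (rule constant_on_clique[of "{s - i..<s + t - i}" r])
        (use c that assms in \<open>auto simp: two_cliques_def\<close>)
    have "x \<in> {..<s} \<or> x \<in> {s - i..<s + t - i}" using x by (auto simp: two_cliques_def)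
    moreover have "s - i \<in> {..<s} \<inter> {s - i..<s + t - i}" using assms by auto
    ultimately show "\<phi> x = \<phi> (s - i)" using A B by blast
  qed
qed (use assms in \<open>auto simp: two_cliques_def\<close>)

lemma bridged_cliques_block_free:
  assumes "2 \<le> r" "r \<le> k" "2 \<le> j" "r \<le> j + 1"
  shows "\<not> contains_copy ({..<m * k}, block_edges r k m) (bridged_cliques r k j)"
proof (rule block_graph_free)
  show "\<exists>p. \<forall>x\<in>verts (bridged_cliques r k j). \<phi> x = p"
    if c: "\<And>e. e \<in> edges (bridged_cliques r k j) \<Longrightarrow> \<exists>p. \<forall>x\<in>e. \<phi> x = p" for \<phi> :: "nat \<Rightarrow> nat"
  proof (intro exI ballI)
    fix x assume "x \<in> verts (bridged_cliques r k j)"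
    then have x: "x < j * k" by (simp add: bridged_cliques_def)
    define i where "i = x div k"
    have i: "i < j" using x by (simp add: i_def less_mult_imp_div_less)
    have le: "i * k + k \<le> j * k" using i mult_le_mono1[OF Suc_leI, of _ j k]
      by (simp add: add.commute)
    have "\<phi> x = \<phi> (i * k)"
    proof (rule constant_on_clique[of "{i * k..<i * k + k}" r \<phi>])
      fix e assume e: "e \<in> nsets {i * k..<i * k + k} r"
      have "\<forall>x\<in>e. x div k = i"
        using e block_eq_div[of k _ i] assms by (auto simp: nsets_def)
      moreover have "e \<in> nsets {..<j * k} r"
        using e le by (auto simp: nsets_def)
      ultimately have "e \<in> edges (bridged_cliques r k j)"
        by (auto simp: bridged_cliques_def block_edges_def)
      then show "\<exists>p. \<forall>x\<in>e. \<phi> x = p" by (rule c)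
    qed (use assms block_eq_div[of k x i] in \<open>auto simp: i_def\<close>)
    also have "\<dots> = \<phi> 0"
    proof -
      have "\<exists>p. \<forall>x\<in>bridge r k j. \<phi> x = p" by (rule c) (simp add: bridged_cliques_def)
      moreover have "i * k \<in> bridge r k j" using i by (auto simp: bridge_def)
      moreover have "0 \<in> bridge r k j" using assms by (force simp: bridge_def)
      ultimately show ?thesis by metis
    qed
    finally show "\<phi> x = \<phi> 0" .
  qed
qed (use assms in \<open>auto simp: bridged_cliques_def\<close>)

text \<open>
  Each edge lies in the union of \<open>d\<close> blocks, which has \<open>d k\<close> elements, and there are at most \<open>m^d\<close>
  ways to choose the blocks.
\<close>
lemma card_edges_few_parts:
  assumes E: "E \<subseteq> Pow {..<m * k}" and few: "\<And>e. e \<in> E \<Longrightarrow> card ((\<lambda>x. x div k) ` e) \<le> d"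
    and m: "d \<le> m" and k: "0 < k"
  shows "card E \<le> 2 ^ (d * k) * m ^ d"
proof -
  define U where "U J = (\<Union>p\<in>J. {p * k..<p * k + k})" for J
  have "E \<subseteq> (\<Union>J\<in>nsets {..<m} d. Pow (U J))"
  proof
    fix e assume e: "e \<in> E"
    let ?P = "(\<lambda>x. x div k) ` e"
    have "e \<subseteq> {..<m * k}" using e E by auto
    then have "?P \<subseteq> {..<m}" by (auto simp: less_mult_imp_div_less)
    then obtain J where J: "?P \<subseteq> J" "J \<subseteq> {..<m}" "card J = d"
      using exists_subset_between[of ?P d "{..<m}"] few[OF e] m by auto
    have "e \<subseteq> U J"
    proof
      fix x assume "x \<in> e"
      then have "x div k \<in> J" using J by auto
      moreover have "x \<in> {x div k * k..<x div k * k + k}"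
        using k by (simp only: block_eq_div)
      ultimately show "x \<in> U J" unfolding U_def by blast
    qed
    moreover have "J \<in> nsets {..<m} d" using J finite_subset[OF J(2)] by (auto simp: nsets_def)
    ultimately show "e \<in> (\<Union>J\<in>nsets {..<m} d. Pow (U J))" by blast
  qed
  moreover have fin: "finite (nsets {..<m} d)" by (simp add: finite_imp_finite_nsets)
  moreover have finU: "finite (U J)" if "J \<in> nsets {..<m} d" for J
    using that by (auto simp: U_def nsets_def)
  ultimately have "card E \<le> card (\<Union>J\<in>nsets {..<m} d. Pow (U J))"
    by (intro card_mono) auto
  also have "\<dots> \<le> (\<Sum>J\<in>nsets {..<m} d. card (Pow (U J)))" by (rule card_UN_le[OF fin])
  also have "\<dots> \<le> (\<Sum>J\<in>nsets {..<m} d. 2 ^ (d * k))"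
  proof (rule sum_mono)
    fix J assume J: "J \<in> nsets {..<m} d"
    then have "card (U J) \<le> (\<Sum>p\<in>J. card {p * k..<p * k + k})"
      unfolding U_def by (intro card_UN_le) (auto simp: nsets_def)
    also have "\<dots> = d * k" using J by (simp add: nsets_def)
    finally show "card (Pow (U J)) \<le> 2 ^ (d * k)" using finU[OF J] by (simp add: card_Pow)
  qed
  also have "\<dots> = (m choose d) * 2 ^ (d * k)" by simp
  also have "\<dots> \<le> m ^ d * 2 ^ (d * k)" by (intro mult_right_mono binomial_le_pow m) auto
  finally show ?thesis by (simp add: mult.commute)
qed

section \<open>The family and its saturation numbers\<close>

text \<open>
  The family for which the quotients oscillate, with cliques of size \<open>2r\<close>.
\<close>
definition osc_family :: "nat \<Rightarrow> nat hgraph set" where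
  "osc_family r = {bridged_cliques r (2 * r) (r - 1), bridged_cliques r (2 * r) r,
     two_cliques r (2 * r) (r + 1) 1, two_cliques r (2 * r) r (r - 1)}"

lemma isomorphic_card_verts:
  assumes "isomorphic F G"
  shows "card (verts F) = card (verts G)"
  using assms bij_betw_same_card by (auto simp: isomorphic_def)

lemma osc_family_members:
  assumes "3 \<le> r" "F \<in> osc_family r"
  shows "anchored r (2 * r) F \<and> r_graph r F"
proof -
  have "anchored r (2 * r) (two_cliques r (2 * r) (r + 1) 1)"
    "anchored r (2 * r) (two_cliques r (2 * r) r (r - 1))"
    "anchored r (2 * r) (bridged_cliques r (2 * r) j)"
    "r_graph r (bridged_cliques r (2 * r) j)" if "j = r \<or> j = r - 1" for j
    using that assms(1)
    by (auto intro!: anchored_bridged_cliques r_graph_bridged_cliques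
        anchored_two_cliques_single[simplified] anchored_two_cliques_large[simplified])
  then show ?thesis
    using assms r_graph_two_cliques[of 1 "r + 1" r "2 * r"]
      r_graph_two_cliques[of "r - 1" r r "2 * r"]
    unfolding osc_family_def by auto
qed

lemma r_graph_family_osc:
  assumes r: "3 \<le> r"
  shows "r_graph_family r 4 (osc_family r)"
proof -
  let ?n = "\<lambda>F :: nat hgraph. card (verts F)"
  let ?F1 = "bridged_cliques r (2 * r) (r - 1)" and ?F2 = "bridged_cliques r (2 * r) r"
    and ?F3 = "two_cliques r (2 * r) (r + 1) 1" and ?F4 = "two_cliques r (2 * r) r (r - 1)"
  have n: "?n ?F1 = (r - 1) * (2 * r)" "?n ?F2 = r * (2 * r)" "?n ?F3 = 3 * r" "?n ?F4 = 2 * r + 1"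
    using r by (auto simp: bridged_cliques_def two_cliques_def)
  have "2 * (2 * r) \<le> (r - 1) * (2 * r)" using r by (intro mult_right_mono) auto
  moreover have "(r - 1) * (2 * r) < r * (2 * r)" using r by (intro mult_strict_right_mono) auto
  ultimately have lt: "?n ?F4 < ?n ?F3" "?n ?F3 < ?n ?F1" "?n ?F1 < ?n ?F2" using n r by linarith+
  then have inj: "inj_on ?n (osc_family r)" by (auto simp: osc_family_def inj_on_def)
  \<comment> \<open>The four members are distinguished by their numbers of vertices.\<close>
  have ne: "F \<noteq> G" if "?n F < ?n G" for F G :: "nat hgraph" using that by auto
  have "card (osc_family r) = 4"
    using ne[OF lt(1)] ne[OF lt(2)] ne[OF lt(3)] ne[OF less_trans[OF lt(1,2)]]
      ne[OF less_trans[OF lt(2,3)]] ne[OF less_trans[OF lt(1) less_trans[OF lt(2,3)]]]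
    by (simp add: osc_family_def)
  moreover have "finite (osc_family r)" by (simp add: osc_family_def)
  moreover have "pairwise (\<lambda>F G. \<not> isomorphic F G) (osc_family r)"
    using inj isomorphic_card_verts unfolding pairwise_def inj_on_def by blast
  ultimately show ?thesis using osc_family_members[OF r] by (auto simp: r_graph_family_def)
qed

lemma osc_family_edges_nonempty:
  assumes "3 \<le> r"
  shows "\<forall>F\<in>osc_family r. edges F \<noteq> {}"
proof -
  have "nsets {..<2 * r} r \<noteq> {}" by (simp add: nsets_eq_empty_iff)
  then show ?thesis by (auto simp: osc_family_def bridged_cliques_def two_cliques_def)
qed

lemma osc_family_block_free:
  assumes "3 \<le> r" "F \<in> osc_family r"
  shows "\<not> contains_copy ({..<m * (2 * r)}, block_edges r (2 * r) m) F"
  using assms(2) bridged_cliques_block_free[of r "2 * r"] two_cliques_block_free[of r "2 * r"] assms(1)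
  unfolding osc_family_def by auto

lemma sat_osc_lower:
  assumes r: "3 \<le> r" and n: "\<not> 2 * r dvd n"
  shows "(n - 1) choose (r - 1) \<le> r * sat r (osc_family r) n"
proof (rule ccontr)
  assume few: "\<not> ?thesis"
  obtain H :: "nat hgraph" where H: "card (verts H) = n" "saturated r (osc_family r) H"
    "sat r (osc_family r) n = card (edges H)"
    using sat_attained[OF osc_family_edges_nonempty[OF r]] by metis
  have fin: "finite (verts H)" using H by (simp add: saturated_def r_graph_def)
  have free: "\<not> contains_copy H (two_cliques r (2 * r) (r + 1) 1)"
    "\<not> contains_copy H (two_cliques r (2 * r) r (r - 1))"
    using H by (auto simp: saturated_def osc_family_def)
  have "2 * r dvd card (verts H)"
  proof (rule dvd_card_of_clique_partition[OF fin])
    show "\<exists>Q. clique_in r H Q \<and> card Q = 2 * r \<and> v \<in> Q" if "v \<in> verts H" for v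
      using saturated_vertex_in_clique[OF H(2) osc_family_members[OF r] _ that] few H r by simp
    show "Q \<inter> Q' = {}" if "clique_in r H Q" "card Q = 2 * r" "clique_in r H Q'" "card Q' = 2 * r"
      "Q \<noteq> Q'" for Q Q'
      by (rule cliques_disjoint[OF that(1,2,3,4) _ _ that(5) _ _ free])
        (use that fin r in \<open>auto simp: clique_in_def intro: finite_subset\<close>)
  qed
  then show False using n H by simp
qed

lemma sat_osc_upper:
  assumes r: "3 \<le> r" and m: "r \<le> m"
  shows "sat r (osc_family r) (m * (2 * r)) \<le> 2 ^ ((r - 2) * (2 * r)) * m ^ (r - 2)"
proof -
  let ?k = "2 * r"
  have "r_graph r ({..<m * ?k}, block_edges r ?k m)" by (auto simp: r_graph_def block_edges_def)
  then obtain H where V: "verts H = {..<m * ?k}" and sub: "block_edges r ?k m \<subseteq> edges H"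
    and sat: "saturated r (osc_family r) H"
    using exists_saturated_supergraph[of r "({..<m * ?k}, block_edges r ?k m)" "osc_family r"]
      osc_family_block_free[OF r] by auto
  have E: "edges H \<subseteq> nsets {..<m * ?k} r" using sat V by (auto simp: saturated_def r_graph_def)
  have free: "\<not> contains_copy H (bridged_cliques r ?k (r - 1))"
    "\<not> contains_copy H (bridged_cliques r ?k r)"
    using sat by (auto simp: saturated_def osc_family_def)
  have "card ((\<lambda>x. x div ?k) ` e) \<le> r - 2" if e: "e \<in> edges H" for e
  proof -
    have en: "e \<in> nsets {..<m * ?k} r" using e E by blast
    define c where "c = card ((\<lambda>x. x div ?k) ` e)"
    have "c \<le> r"
      using en card_image_le[of e "\<lambda>x. x div ?k"] by (auto simp: nsets_def c_def)
    moreover have "c \<noteq> j" if "j = r \<or> j = r - 1" for j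
      using contains_bridged_cliques[OF V sub e en] free that r by (auto simp: c_def)
    then have "c \<noteq> r" "c \<noteq> r - 1" by auto
    ultimately have "c \<le> r - 2" by linarith
    then show ?thesis by (simp add: c_def)
  qed
  then have "card (edges H) \<le> 2 ^ ((r - 2) * ?k) * m ^ (r - 2)"
    using E m r by (intro card_edges_few_parts) (auto simp: nsets_def)
  moreover have "sat r (osc_family r) (m * ?k) \<le> card (edges H)" using sat_le[OF sat] V by simp
  ultimately show ?thesis by linarith
qed

theorem theorem4:
  fixes r :: nat
  assumes "r \<ge> 3"
  shows "\<exists>\<F> :: nat hgraph set. r_graph_family r 4 \<F> \<and>
           \<not> convergent (\<lambda>n. real (sat r \<F> n) / real n ^ (r - 1))"
proof (intro exI[of _ "osc_family r"] conjI notI)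
  show "r_graph_family r 4 (osc_family r)" by (rule r_graph_family_osc[OF assms])
  let ?q = "\<lambda>n. real (sat r (osc_family r) n) / real n ^ (r - 1)"
  let ?k = "2 * r"
  assume "convergent ?q"
  then obtain L where L: "?q \<longlonglongrightarrow> L" by (auto simp: convergent_def)
  have "(\<lambda>m. ?q (m * ?k)) \<longlonglongrightarrow> 0"
  proof (rule tendsto_sandwich[of "\<lambda>_. 0" _ _ "\<lambda>m. 2 ^ ((r - 2) * ?k) * inverse (real m)"])
    show "\<forall>\<^sub>F m in sequentially. ?q (m * ?k) \<le> 2 ^ ((r - 2) * ?k) * inverse (real m)"
    proof (rule eventually_sequentiallyI[of r])
      fix m assume m: "r \<le> m"
      have r1: "r - 1 = Suc (r - 2)" using assms by simp
      have "real m ^ (r - 1) \<le> real (m * ?k) ^ (r - 1)"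
        using assms by (intro power_mono) (auto simp: mult_le_cancel_left1)
      moreover have "0 < real m ^ (r - 1)" using m assms by simp
      moreover have "real (sat r (osc_family r) (m * ?k)) \<le> 2 ^ ((r - 2) * ?k) * real m ^ (r - 2)"
        using of_nat_mono[OF sat_osc_upper[OF assms m], where 'a = real] by simp
      ultimately have "?q (m * ?k) \<le> (2 ^ ((r - 2) * ?k) * real m ^ (r - 2)) / real m ^ (r - 1)"
        by (intro frac_le) auto
      also have "\<dots> = 2 ^ ((r - 2) * ?k) * inverse (real m)"
        using m assms unfolding r1 by (simp add: field_simps)
      finally show "?q (m * ?k) \<le> 2 ^ ((r - 2) * ?k) * inverse (real m)" .
    qed
    show "(\<lambda>m. 2 ^ ((r - 2) * ?k) * inverse (real m)) \<longlonglongrightarrow> 0"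
      by (intro tendsto_mult_right_zero LIMSEQ_inverse_real_of_nat[THEN LIMSEQ_imp_Suc])
  qed auto
  moreover have "(\<lambda>m. ?q (m * ?k)) \<longlonglongrightarrow> L"
    by (rule filterlim_compose[OF L], rule filterlim_subseq)
      (use assms in \<open>auto simp: strict_mono_def\<close>)
  ultimately have "L = 0" using LIMSEQ_unique by blast
  define c where "c = 1 / (real r * (2 * real (r - 1)) ^ (r - 1))"
  have c: "0 < c" using assms by (simp add: c_def)
  have "(\<lambda>m. ?q (m * ?k + 1)) \<longlonglongrightarrow> L"
    by (rule filterlim_compose[OF L], rule filterlim_subseq)
      (use assms in \<open>auto simp: strict_mono_def\<close>)
  moreover have "\<forall>\<^sub>F m in sequentially. c \<le> ?q (m * ?k + 1)"
  proof (rule eventually_sequentiallyI[of 1])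
    fix m :: nat assume m: "1 \<le> m"
    define N where "N = m * ?k"
    have N: "r - 1 \<le> N" "1 \<le> N" using m assms by (auto simp: N_def intro: order_trans[of _ "1 * ?k"])
    have nd: "\<not> ?k dvd N + 1"
    proof
      assume "?k dvd N + 1"
      moreover have "?k dvd N" by (simp add: N_def)
      ultimately have "?k dvd 1" using dvd_add_right_iff by blast
      then show False using assms by simp
    qed
    have "(real N / real (r - 1)) ^ (r - 1) \<le> real (N choose (r - 1))"
      by (rule binomial_ge_n_over_k_pow_k[OF N(1)])
    also have "\<dots> \<le> real r * real (sat r (osc_family r) (N + 1))"
      using of_nat_mono[OF sat_osc_lower[OF assms nd], where 'a = real] by simp
    finally have low: "(real N / real (r - 1)) ^ (r - 1) \<le> real r * real (sat r (osc_family r) (N + 1))" .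
    \<comment> \<open>The constant \<open>c\<close> comes from \<open>N + 1 \<le> 2 N\<close> and \<open>(N / d) ^ d \<le> N choose d\<close> for \<open>d = r - 1\<close>.\<close>
    have "c * real (N + 1) ^ (r - 1) \<le> c * (2 * real N) ^ (r - 1)"
      using c N by (intro mult_left_mono power_mono) auto
    also have "\<dots> = (real N / real (r - 1)) ^ (r - 1) / real r"
    proof -
      have "1 / (real r * (2 * b) ^ d) * (2 * x) ^ d = (x / b) ^ d / real r" for b x :: real and d
        by (simp add: power_mult_distrib power_divide)
      then show ?thesis unfolding c_def .
    qed
    also have "\<dots> \<le> real (sat r (osc_family r) (N + 1))"
      using low assms by (simp add: divide_le_eq mult.commute)
    finally show "c \<le> ?q (m * ?k + 1)" unfolding N_def[symmetric] by (simp add: le_divide_eq)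
  qed
  ultimately have "c \<le> L" by (rule tendsto_lowerbound) simp
  then show False using c \<open>L = 0\<close> by simp
qed

end
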